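(* Let $\mathbf{k}$ be a commutative ring and $n\in\mathbb{N}$. Let $w\in S_n$ and $\ell\in[n]$. Let $i=\operatorname{Qind}w$. Then $$a_wt_\ell=m_{Q_i,\ell}\,a_w+\left(\text{a }\mathbf{k}\text{-linear combination of }a_v\text{'s for }v\in S_n\text{ satisfying }\operatorname{Qind}v<i\right).$$
   Context: $\mathbb{N}=\{0,1,2,\ldots\}$; $[m]=\{1,\ldots,m\}$ (empty if $m\le 0$). $S_n$ is the group of permutations of $[n]$, with product $(\pi\sigma)(i)=\pi(\sigma(i))$; $\mathbf{k}[S_n]$ is its group algebra. For distinct $i_1,\ldots,i_k\in[n]$, $\operatorname{cyc}_{i_1,\ldots,i_k}\in S_n$ sends $i_1,\ldots,i_{k-1},i_k$ to $i_2,\ldots,i_k,i_1$, respectively, and fixes all other elements. For $\ell\in[n]$, $t_\ell:=\operatorname{cyc}_\ell+\operatorname{cyc}_{\ell,\ell+1}+\cdots+\operatorname{cyc}_{\ell,\ell+1,\ldots,n}\in\mathbf{k}[S_n]$. For $i\in[n-1]$, $s_i:=\operatorname{cyc}_{i,i+1}$. For $w\in S_n$, $\operatorname{Des}w:=\{i\in[n-1]\mid w(i)>w(i+1)\}$. For $I\subseteq[n-1]$, $G(I)$ is the subgroup of $S_n$ generated by $\{s_i\mid i\in I\}$. For $w\in S_n$, $a_w:=\sum_{\sigma\in G(\operatorname{Des}w)}w\sigma\in\mathbf{k}[S_n]$. Fibonacci numbers: $f_0=0$, $f_1=1$, $f_m=f_{m-1}+f_{m-2}$. A set of integers is lacunar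 if it contains no two consecutive integers. For a finite set $I$ of integers, $\operatorname{sum}I$ is the sum of its elements. There are exactly $f_{n+1}$ lacunar subsets of $[n-1]$; fix a listing $Q_1,Q_2,\ldots,Q_{f_{n+1}}$ of all of them, without repetition, such that $\operatorname{sum}(Q_1)\le\cdots\le\operatorname{sum}(Q_{f_{n+1}})$. For $I\subseteq[n]$: $\widehat I:=\{0\}\cup I\cup\{n+1\}$; $m_{I,\ell}:=(\text{smallest element of }\widehat I\text{ that is}\ge\ell)-\ell$ for $\ell\in[n]$; $I':=\{i\in[n-1]\mid i\notin I\text{ and }i+1\notin I\}$. For $w\in S_n$, $\operatorname{Qind}w$ is the smallest $i\in[f_{n+1}]$ such that $Q_i'\subseteq\operatorname{Des}w$ (such an $i$ always exists). *)

theory Defs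
  imports
    "HOL-Algebra.Sym_Groups"
    "HOL-Number_Theory.Fib"
    "HOL-Library.Function_Algebras"
begin

text \<open>
  The symmetric group on \<open>[n] = {1..n}\<close> is the library's \<^const>\<open>sym_group\<close>; its product is
  \<^const>\<open>comp\<close>, so \<open>(\<pi> \<circ> \<sigma>) i = \<pi> (\<sigma> i)\<close>.

  Coefficients range over the sort \<open>{comm_ring, comm_monoid_mult}\<close>, i.e. commutative rings with
  unity. Unlike \<^class>\<open>comm_ring_1\<close>, this sort does not demand \<open>0 \<noteq> 1\<close>, so the zero ring
  is allowed.

  An element of the group algebra is represented by its coefficient function, which vanishes outside
  \<open>carrier (sym_group n)\<close>. Addition and finite sums are pointwise (from
  \<open>Function_Algebras\<close>); the product is the convolution \<open>ga_mult\<close>, not the pointwise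
  \<open>*\<close>.
\<close>

definition ga_basis :: "(nat \<Rightarrow> nat) \<Rightarrow> (nat \<Rightarrow> nat) \<Rightarrow> 'k::{comm_ring, comm_monoid_mult}" where
  "ga_basis \<pi> = (\<lambda>\<tau>. if \<tau> = \<pi> then 1 else 0)"

definition ga_smult ::
  "'k::{comm_ring, comm_monoid_mult} \<Rightarrow> ((nat \<Rightarrow> nat) \<Rightarrow> 'k) \<Rightarrow> (nat \<Rightarrow> nat) \<Rightarrow> 'k" where
  "ga_smult c a = (\<lambda>\<tau>. c * a \<tau>)"

definition ga_mult ::
  "nat \<Rightarrow> ((nat \<Rightarrow> nat) \<Rightarrow> 'k::{comm_ring, comm_monoid_mult}) \<Rightarrow> ((nat \<Rightarrow> nat) \<Rightarrow> 'k)
     \<Rightarrow> (nat \<Rightarrow> nat) \<Rightarrow> 'k" where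
  "ga_mult n a b = (\<lambda>\<tau>. \<Sum>(\<pi>, \<sigma>) \<in> {(\<pi>, \<sigma>).
     \<pi> \<in> carrier (sym_group n) \<and> \<sigma> \<in> carrier (sym_group n) \<and> \<pi> \<circ> \<sigma> = \<tau>}. a \<pi> * b \<sigma>)"

text \<open>The image of a natural number in the coefficient ring; \<^const>\<open>of_nat\<close> would need \<open>0 \<noteq> 1\<close>.\<close>

definition scalar_of_nat :: "nat \<Rightarrow> 'k::{comm_ring, comm_monoid_mult}" where
  "scalar_of_nat m = (\<Sum>j<m. 1)"

definition t_elt :: "nat \<Rightarrow> nat \<Rightarrow> (nat \<Rightarrow> nat) \<Rightarrow> 'k::{comm_ring, comm_monoid_mult}" where
  "t_elt n l = (\<Sum>j\<in>{l..n}. ga_basis (cycle_of_list [l..<Suc j]))"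

definition s_perm :: "nat \<Rightarrow> nat \<Rightarrow> nat" where
  "s_perm i = cycle_of_list [i, i + 1]"

text \<open>For \<open>n = 0\<close> truncated subtraction gives \<open>{1..n-1} = {}\<close>, as intended for \<open>[n-1]\<close>.\<close>

definition Des :: "nat \<Rightarrow> (nat \<Rightarrow> nat) \<Rightarrow> nat set" where
  "Des n w = {i \<in> {1..n-1}. w i > w (i + 1)}"

definition G_sub :: "nat \<Rightarrow> nat set \<Rightarrow> (nat \<Rightarrow> nat) set" where
  "G_sub n I = generate (sym_group n) (s_perm ` I)"

definition a_elt :: "nat \<Rightarrow> (nat \<Rightarrow> nat) \<Rightarrow> (nat \<Rightarrow> nat) \<Rightarrow> 'k::{comm_ring, comm_monoid_mult}" where
  "a_elt n w = (\<Sum>\<sigma>\<in>G_sub n (Des n w). ga_basis (w \<circ> \<sigma>))"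

definition lacunar :: "nat set \<Rightarrow> bool" where
  "lacunar I \<longleftrightarrow> (\<forall>i\<in>I. i + 1 \<notin> I)"

text \<open>Only the values of \<open>Q\<close> on \<open>{1..fib (n + 1)}\<close> matter.\<close>

definition lacunar_listing :: "nat \<Rightarrow> (nat \<Rightarrow> nat set) \<Rightarrow> bool" where
  "lacunar_listing n Q \<longleftrightarrow>
     bij_betw Q {1..fib (n + 1)} {I. I \<subseteq> {1..n-1} \<and> lacunar I} \<and>
     mono_on {1..fib (n + 1)} (\<lambda>i. \<Sum>(Q i))"

definition hat :: "nat \<Rightarrow> nat set \<Rightarrow> nat set" where
  "hat n I = {0} \<union> I \<union> {n + 1}"

definition m_coeff :: "nat \<Rightarrow> nat set \<Rightarrow> nat \<Rightarrow> nat" where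
  "m_coeff n I l = (LEAST k. k \<in> hat n I \<and> l \<le> k) - l"

text \<open>The set written \<open>I'\<close>; nothing to do with prime numbers.\<close>

definition prime_set :: "nat \<Rightarrow> nat set \<Rightarrow> nat set" where
  "prime_set n I = {i \<in> {1..n-1}. i \<notin> I \<and> i + 1 \<notin> I}"

definition Qind :: "nat \<Rightarrow> (nat \<Rightarrow> nat set) \<Rightarrow> (nat \<Rightarrow> nat) \<Rightarrow> nat" where
  "Qind n Q w = (LEAST i. i \<in> {1..fib (n + 1)} \<and> prime_set n (Q i) \<subseteq> Des n w)"

end

theory Submission
  imports Defs
begin

text \<open>
  For \<open>I \<subseteq> [n]\<close> let \<open>F(I)\<close> be the space of elements of the group algebra that are invariant under
  right multiplication by \<open>s\<^sub>k\<close> for all \<open>k \<in> I'\<close>. The theorem is a statement about these spaces: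
  \<open>t\<^sub>l\<close> acts on \<open>F(I)\<close> as the scalar \<open>m\<^bsub>I,l\<^esub>\<close>, up to spaces \<open>F(J)\<close> with smaller \<open>sum J\<close>.

  To see this, take \<open>q \<in> F(I)\<close> and let \<open>p\<close> be the smallest element of \<open>I \<union> {n + 1}\<close> that is at least \<open>l\<close>.
  The cycle \<open>l, \<dots>, j\<close> equals \<open>s\<^sub>l \<cdots> s\<^bsub>j-1\<^esub>\<close>, and \<open>s\<^sub>l, \<dots>, s\<^bsub>p-2\<^esub>\<close> fix \<open>q\<close>. So each of the
  \<open>p - l = m\<^bsub>I,l\<^esub>\<close> terms of \<open>q t\<^sub>l\<close> with \<open>j < p\<close> is just \<open>q\<close>. The other terms are grouped into blocks
  \<open>a \<le> j < b\<close>, where \<open>a < b\<close> are neighbours in \<open>I \<union> {n + 1}\<close> and \<open>a \<ge> p\<close>. The sum over such a block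
  lies in \<open>F(J)\<close>, where \<open>J\<close> arises from \<open>I\<close> by lowering every element in \<open>{p..a}\<close> by one
  (\<open>block_sum_invariant\<close>). At least \<open>p\<close> itself is lowered, so \<open>sum J < sum I\<close>.

  Two facts translate this into the language of the elements \<open>a\<^sub>w\<close>. The set \<open>J\<close> can have adjacent
  elements or contain \<open>n\<close>. Lowering offending elements one at a time decreases the sum, never
  enlarges the primed set, and ends in a lacunar subset of \<open>[n - 1]\<close> (\<open>lacunar_reduction\<close>), which is
  some \<open>Q\<^sub>j\<close>.
  And every element invariant under the \<open>s\<^sub>k\<close> with \<open>k \<in> K\<close> is a combination of the \<open>a\<^sub>v\<close> with
  \<open>K \<subseteq> Des v\<close>, because the lexicographically largest word in \<open>a\<^sub>v\<close> is \<open>v\<close> and the largest word in the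
  support of an invariant element has all of \<open>K\<close> as descents (\<open>invariant_in_a_span\<close>). Since \<open>a\<^sub>w\<close> lies
  in \<open>F(Q\<^sub>i)\<close> for \<open>i = Qind w\<close>, the theorem follows.
\<close>

section \<open>Adjacent transpositions and inverse cycles\<close>

lemma s_perm_eq: "s_perm i = transpose i (Suc i)"
  by (simp add: s_perm_def)

lemma s_perm_invol: "s_perm i \<circ> s_perm i = id"
  by (simp add: s_perm_eq)

lemma s_perm_permutes: "i \<in> {1..n-1} \<Longrightarrow> s_perm i permutes {1..n}"
  unfolding s_perm_eq by (rule permutes_swap_id) auto

text \<open>
  Right multiplication by a permutation \<open>c\<close> turns a coefficient function \<open>q\<close> into
  \<open>\<lambda>\<tau>. q (\<tau> \<circ> c\<^sup>-\<^sup>1)\<close>, so only the inverses of the cycles ever occur below. This is the inverse of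
  the cycle \<open>r, r + 1, \<dots>, j\<close> in closed form, which lets the relations with adjacent
  transpositions be checked pointwise.
\<close>

definition inv_cyc :: "nat \<Rightarrow> nat \<Rightarrow> nat \<Rightarrow> nat" where
  "inv_cyc r j x = (if x = r then j else if r < x \<and> x \<le> j then x - 1 else x)"

lemma inv_cyc_self: "inv_cyc r r = id"
  by (auto simp: inv_cyc_def fun_eq_iff)

lemma inv_cyc_left: "r < j \<Longrightarrow> inv_cyc r j = inv_cyc (Suc r) j \<circ> s_perm r"
  by (auto simp: inv_cyc_def fun_eq_iff s_perm_eq transpose_def)

text \<open>
  Together with its companion, this says that \<open>s\<^sub>j\<close> swaps the cycles ending in \<open>j\<close> and \<open>j + 1\<close>. A sum
  of cycles that contains both of them is therefore invariant under \<open>s\<^sub>j\<close> as far as these two terms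
  are concerned, even if \<open>q\<close> itself is not.
\<close>

lemma inv_cyc_right: "r \<le> j \<Longrightarrow> s_perm j \<circ> inv_cyc r j = inv_cyc r (Suc j)"
  by (auto simp: inv_cyc_def fun_eq_iff s_perm_eq transpose_def)

lemma inv_cyc_right': "r \<le> j \<Longrightarrow> s_perm j \<circ> inv_cyc r (Suc j) = inv_cyc r j"
  by (auto simp: inv_cyc_def fun_eq_iff s_perm_eq transpose_def)

lemma inv_cyc_split: "l \<le> r \<Longrightarrow> r \<le> j \<Longrightarrow> inv_cyc l j = inv_cyc r j \<circ> inv_cyc l r"
  by (auto simp: inv_cyc_def fun_eq_iff)

lemma inv_cyc_commute_outside:
  "r \<le> j \<Longrightarrow> Suc i < r \<or> j < i \<Longrightarrow> s_perm i \<circ> inv_cyc r j = inv_cyc r j \<circ> s_perm i"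
  by (auto simp: inv_cyc_def fun_eq_iff s_perm_eq transpose_def)

text \<open>
  Conjugation by a cycle shifts the transpositions inside its range by one. This is why invariance
  of \<open>q\<close> under \<open>s\<^bsub>i+1\<^esub>\<close> yields invariance of the product under \<open>s\<^sub>i\<close>, and ultimately why elements of
  \<open>I\<close> get lowered by one.
\<close>

lemma inv_cyc_shift_inside:
  "r \<le> i \<Longrightarrow> Suc (Suc i) \<le> j \<Longrightarrow> s_perm i \<circ> inv_cyc r j = inv_cyc r j \<circ> s_perm (Suc i)"
  by (auto simp: inv_cyc_def fun_eq_iff s_perm_eq transpose_def)

lemma cycle_of_list_upt_left:
  assumes "r < j"
  shows "cycle_of_list [r..<Suc j] = s_perm r \<circ> cycle_of_list [Suc r..<Suc j]"
proof -
  have "[r..<Suc j] = r # Suc r # [Suc (Suc r)..<Suc j]"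
    using assms by (simp add: upt_conv_Cons del: upt_Suc)
  moreover have "[Suc r..<Suc j] = Suc r # [Suc (Suc r)..<Suc j]"
    using assms by (simp add: upt_conv_Cons del: upt_Suc)
  ultimately show ?thesis by (simp add: s_perm_eq del: upt_Suc)
qed

lemma inv_cyc_cycle:
  assumes "r \<le> j"
  shows "inv_cyc r j \<circ> cycle_of_list [r..<Suc j] = id \<and>
         cycle_of_list [r..<Suc j] \<circ> inv_cyc r j = id"
  using assms
proof (induction rule: inc_induct)
  case base
  then show ?case by (simp add: inv_cyc_self)
next
  case (step r)
  let ?c = "cycle_of_list [Suc r..<Suc j]"
  have "inv_cyc r j \<circ> cycle_of_list [r..<Suc j] = inv_cyc (Suc r) j \<circ> (s_perm r \<circ> s_perm r) \<circ> ?c"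
    using step.hyps by (simp only: inv_cyc_left cycle_of_list_upt_left comp_assoc)
  moreover have "cycle_of_list [r..<Suc j] \<circ> inv_cyc r j
      = s_perm r \<circ> (?c \<circ> inv_cyc (Suc r) j) \<circ> s_perm r"
    using step.hyps by (simp only: inv_cyc_left cycle_of_list_upt_left comp_assoc)
  moreover have "inv_cyc (Suc r) j \<circ> ?c = id" "?c \<circ> inv_cyc (Suc r) j = id"
    using step.IH by blast+
  ultimately show ?case
    by (simp only: s_perm_invol comp_id simp_thms)
qed

lemma inv_cycle_of_list_upt: "r \<le> j \<Longrightarrow> inv' (cycle_of_list [r..<Suc j]) = inv_cyc r j"
  using inv_cyc_cycle by (intro inv_unique_comp) auto

lemma inv_cyc_permutes:
  assumes "1 \<le> r" "r \<le> j" "j \<le> n"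
  shows "inv_cyc r j permutes {1..n}"
proof -
  have "cycle_of_list [r..<Suc j] permutes {1..n}"
    using cycle_permutes[of "[r..<Suc j]"] assms
    by (elim permutes_subset) auto
  from permutes_inv[OF this] show ?thesis
    using assms by (simp add: inv_cycle_of_list_upt del: upt_Suc)
qed

section \<open>Pointwise formulas in the group algebra\<close>

lemma sum_fun_apply:
  fixes F :: "'a \<Rightarrow> 'b \<Rightarrow> 'c::comm_monoid_add"
  shows "(\<Sum>x\<in>A. F x) y = (\<Sum>x\<in>A. F x y)"
  by (induction A rule: infinite_finite_induct) auto

lemma finite_sym_group: "finite (carrier (sym_group n))"
  by (simp add: sym_group_def finite_permutations)

text \<open>
  Vanishing of \<open>q\<close> off the symmetric group removes the side condition on the first factor.
\<close>

lemma ga_mult_eq_sum: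
  assumes "\<And>\<tau>. \<tau> \<notin> carrier (sym_group n) \<Longrightarrow> q \<tau> = 0"
  shows "ga_mult n q b \<tau> = (\<Sum>\<sigma>\<in>carrier (sym_group n). q (\<tau> \<circ> inv' \<sigma>) * b \<sigma>)"
proof -
  let ?S = "carrier (sym_group n)"
  let ?T = "{\<sigma> \<in> ?S. \<tau> \<circ> inv' \<sigma> \<in> ?S}"
  have "ga_mult n q b \<tau> = (\<Sum>\<sigma>\<in>?T. q (\<tau> \<circ> inv' \<sigma>) * b \<sigma>)"
    unfolding ga_mult_def
    by (rule sum.reindex_bij_witness[of _ "\<lambda>\<sigma>. (\<tau> \<circ> inv' \<sigma>, \<sigma>)" snd])
       (auto simp: sym_group_carrier comp_assoc permutes_inv_o)
  also have "\<dots> = (\<Sum>\<sigma>\<in>?S. q (\<tau> \<circ> inv' \<sigma>) * b \<sigma>)"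
    by (rule sum.mono_neutral_left) (auto simp: finite_sym_group assms)
  finally show ?thesis .
qed

lemma ga_mult_t_elt:
  fixes q :: "(nat \<Rightarrow> nat) \<Rightarrow> 'k::{comm_ring, comm_monoid_mult}"
  assumes "\<And>\<tau>. \<tau> \<notin> carrier (sym_group n) \<Longrightarrow> q \<tau> = 0" and "1 \<le> l"
  shows "ga_mult n q (t_elt n l) \<tau> = (\<Sum>j\<in>{l..n}. q (\<tau> \<circ> inv_cyc l j))"
proof -
  let ?S = "carrier (sym_group n)"
  have "ga_mult n q (t_elt n l) \<tau>
      = (\<Sum>\<sigma>\<in>?S. q (\<tau> \<circ> inv' \<sigma>) * t_elt n l \<sigma>)"
    using assms(1) by (rule ga_mult_eq_sum)
  also have "\<dots> = (\<Sum>\<sigma>\<in>?S. \<Sum>j\<in>{l..n}.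
      if \<sigma> = cycle_of_list [l..<Suc j] then q (\<tau> \<circ> inv' \<sigma>) else 0)"
    unfolding t_elt_def sum_fun_apply sum_distrib_left ga_basis_def
    by (intro sum.cong) (auto simp del: upt_Suc)
  also have "\<dots> = (\<Sum>j\<in>{l..n}. \<Sum>\<sigma>\<in>?S.
      if \<sigma> = cycle_of_list [l..<Suc j] then q (\<tau> \<circ> inv' \<sigma>) else 0)"
    by (rule sum.swap)
  also have "\<dots> = (\<Sum>j\<in>{l..n}. q (\<tau> \<circ> inv_cyc l j))"
  proof (rule sum.cong)
    fix j assume j: "j \<in> {l..n}"
    have "cycle_of_list [l..<Suc j] permutes {1..n}"
      using cycle_permutes[of "[l..<Suc j]"] assms(2) j by (elim permutes_subset) auto
    then show "(\<Sum>\<sigma>\<in>?S. if \<sigma> = cycle_of_list [l..<Suc j] then q (\<tau> \<circ> inv' \<sigma>) else 0)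
        = q (\<tau> \<circ> inv_cyc l j)"
      using j by (simp add: sum.delta' sum.delta finite_sym_group sym_group_carrier inv_cycle_of_list_upt del: upt_Suc)
  qed simp
  finally show ?thesis .
qed

section \<open>Invariance and support of the elements \<open>a\<^sub>w\<close>\<close>

text \<open>
  Invariance under right multiplication by the \<open>s\<^sub>k\<close> with \<open>k \<in> K\<close>. For \<open>K = I'\<close> the invariant
  elements of the group algebra form the space \<open>F(I)\<close> of the overview.
\<close>

definition invariant_under :: "nat set \<Rightarrow> ((nat \<Rightarrow> nat) \<Rightarrow> 'k) \<Rightarrow> bool" where
  "invariant_under K f \<longleftrightarrow> (\<forall>k\<in>K. \<forall>\<tau>. f (\<tau> \<circ> s_perm k) = f \<tau>)"

lemma invariant_underD: "invariant_under K f \<Longrightarrow> k \<in> K \<Longrightarrow> f (\<tau> \<circ> s_perm k) = f \<tau>"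
  by (simp add: invariant_under_def)

lemma invariant_under_mono: "invariant_under K f \<Longrightarrow> L \<subseteq> K \<Longrightarrow> invariant_under L f"
  by (auto simp: invariant_under_def)

lemma Des_subset: "Des n w \<subseteq> {1..n-1}"
  by (auto simp: Des_def)

lemma s_perm_block: "{min x (s_perm k x)..<max x (s_perm k x)} \<subseteq> {k}"
  by (auto simp: s_perm_eq transpose_def)

text \<open>
  A product of transpositions \<open>s\<^sub>k\<close> with \<open>k \<in> K\<close> moves each point only within a run of consecutive
  elements of \<open>K\<close>. The relation "every integer from \<open>x\<close> up to just below \<open>y\<close> (or from \<open>y\<close> to just below
  \<open>x\<close>) is in \<open>K\<close>" is transitive, so it passes from the generators to the whole group.
\<close>

lemma G_sub_same_block:
  assumes "\<sigma> \<in> G_sub n K" "K \<subseteq> {1..n-1}"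
  shows "\<sigma> permutes {1..n} \<and> (\<forall>x. {min x (\<sigma> x)..<max x (\<sigma> x)} \<subseteq> K)"
  using assms(1) unfolding G_sub_def
proof (induction rule: generate.induct)
  case one
  then show ?case by (simp add: sym_group_one id_def permutes_id[unfolded id_def])
next
  case (incl h)
  then obtain k where k: "k \<in> K" "h = s_perm k" by auto
  then show ?case using assms(2) s_perm_permutes[of k n] s_perm_block[of _ k] by blast
next
  case (inv h)
  then obtain k where k: "k \<in> K" "h = s_perm k" by auto
  have "s_perm k permutes {1..n}" using k assms(2) s_perm_permutes by auto
  moreover from this have "inv\<^bsub>sym_group n\<^esub> h = h"
    using k by (intro group.inv_equality[OF sym_group_is_group])
      (auto simp: sym_group_carrier sym_group_mult sym_group_one s_perm_invol)
  ultimately show ?case using k s_perm_block[of _ k] by auto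
next
  case (eng g h)
  have "{min x (g (h x))..<max x (g (h x))} \<subseteq> K" for x
  proof -
    have "{min x (h x)..<max x (h x)} \<subseteq> K" "{min (h x) (g (h x))..<max (h x) (g (h x))} \<subseteq> K"
      using eng.IH by auto
    moreover have "{min x (g (h x))..<max x (g (h x))}
        \<subseteq> {min x (h x)..<max x (h x)} \<union> {min (h x) (g (h x))..<max (h x) (g (h x))}"
      by auto
    ultimately show ?thesis by blast
  qed
  moreover have "g \<circ> h permutes {1..n}" using eng.IH by (simp only: permutes_compose)
  ultimately show ?case by (simp add: sym_group_mult o_def)
qed

lemma id_in_G_sub: "id \<in> G_sub n K"
  unfolding G_sub_def using generate.one[of "sym_group n"] by (simp add: sym_group_one)

lemma G_sub_comp_s_perm: "\<sigma> \<in> G_sub n K \<Longrightarrow> k \<in> K \<Longrightarrow> \<sigma> \<circ> s_perm k \<in> G_sub n K"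
  unfolding G_sub_def
  using generate.eng[of \<sigma> "sym_group n" "s_perm ` K" "s_perm k"] generate.incl[of "s_perm k"]
  by (auto simp: sym_group_mult)

lemma finite_G_sub:
  assumes "K \<subseteq> {1..n-1}"
  shows "finite (G_sub n K)"
  by (rule finite_subset[of _ "carrier (sym_group n)"])
     (use G_sub_same_block[OF _ assms] in \<open>auto simp: sym_group_carrier finite_sym_group\<close>)

lemma a_elt_apply:
  assumes "w permutes {1..n}"
  shows "a_elt n w \<tau> = (if \<tau> \<in> (\<circ>) w ` G_sub n (Des n w) then 1 else 0)"
proof -
  have inj: "w \<circ> \<sigma> = w \<circ> \<rho> \<longleftrightarrow> \<sigma> = \<rho>" for \<sigma> \<rho> :: "nat \<Rightarrow> nat"
    using permutes_inj[OF assms] by (auto simp: fun_eq_iff inj_def)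
  show ?thesis
  proof (cases "\<tau> \<in> (\<circ>) w ` G_sub n (Des n w)")
    case True
    then obtain \<rho> where \<rho>: "\<rho> \<in> G_sub n (Des n w)" "\<tau> = w \<circ> \<rho>" by auto
    have "a_elt n w \<tau> = (\<Sum>\<sigma>\<in>G_sub n (Des n w). if \<sigma> = \<rho> then 1 else 0)"
      unfolding a_elt_def sum_fun_apply ga_basis_def \<rho>(2) inj by (intro sum.cong) auto
    also have "\<dots> = 1" using \<rho>(1) by (simp add: finite_G_sub[OF Des_subset])
    finally show ?thesis using True by simp
  next
    case False
    then show ?thesis unfolding a_elt_def sum_fun_apply ga_basis_def
      by (auto intro!: sum.neutral)
  qed
qed

lemma a_elt_support:
  assumes "w permutes {1..n}" "\<tau> \<notin> carrier (sym_group n)"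
  shows "a_elt n w \<tau> = 0"
proof -
  have "w \<circ> \<sigma> \<in> carrier (sym_group n)" if "\<sigma> \<in> G_sub n (Des n w)" for \<sigma>
    using permutes_compose[OF _ assms(1), of \<sigma>] G_sub_same_block[OF that Des_subset]
    by (simp only: sym_group_carrier)
  then have "\<tau> \<notin> (\<circ>) w ` G_sub n (Des n w)" using assms(2) by blast
  then show ?thesis unfolding a_elt_apply[OF assms(1)] by simp
qed

lemma a_elt_invariant:
  assumes "w permutes {1..n}"
  shows "invariant_under (Des n w) (a_elt n w)"
proof -
  let ?G = "G_sub n (Des n w)"
  have step: "\<tau> \<circ> s_perm k \<in> (\<circ>) w ` ?G" if "\<tau> \<in> (\<circ>) w ` ?G" "k \<in> Des n w" for \<tau> k
    using that G_sub_comp_s_perm by (auto simp: comp_assoc intro!: imageI)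
  have "\<tau> \<circ> s_perm k \<in> (\<circ>) w ` ?G \<longleftrightarrow> \<tau> \<in> (\<circ>) w ` ?G" if k: "k \<in> Des n w" for \<tau> k
    using step[OF _ k, of \<tau>] step[OF _ k, of "\<tau> \<circ> s_perm k"]
    by (auto simp: comp_assoc s_perm_invol)
  then show ?thesis unfolding invariant_under_def a_elt_apply[OF assms] by simp
qed

section \<open>Invariant elements are spanned by the elements \<open>a\<^sub>v\<close>\<close>

text \<open>
  The word \<open>u 1, \<dots>, u m\<close> read as a number in base \<open>b\<close> by Horner's scheme. For letters below \<open>b\<close>
  the order of these numbers is the lexicographic order of the words.
\<close>

primrec lex_weight :: "nat \<Rightarrow> nat \<Rightarrow> (nat \<Rightarrow> nat) \<Rightarrow> nat" where
  "lex_weight b 0 u = 0"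
| "lex_weight b (Suc m) u = lex_weight b m u * b + u (Suc m)"

lemma lex_weight_cong: "(\<And>x. 1 \<le> x \<Longrightarrow> x \<le> m \<Longrightarrow> u x = v x) \<Longrightarrow> lex_weight b m u = lex_weight b m v"
  by (induction m) auto

lemma lex_weight_less:
  assumes "j \<in> {1..m}" "\<And>x. 1 \<le> x \<Longrightarrow> x < j \<Longrightarrow> v x = u x" "v j < u j"
    "\<And>x. x \<in> {1..m} \<Longrightarrow> v x < b"
  shows "lex_weight b m v < lex_weight b m u"
  using assms(1,4)
proof (induction m)
  case (Suc m)
  show ?case
  proof (cases "j = Suc m")
    case True
    then have "lex_weight b m v = lex_weight b m u"
      using assms(2) by (intro lex_weight_cong) auto
    then show ?thesis using True assms(3) by simp
  next
    case False
    then have "Suc (lex_weight b m v) \<le> lex_weight b m u" using Suc by (simp add: Suc_leI)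
    then have "Suc (lex_weight b m v) * b \<le> lex_weight b m u * b" by (rule mult_le_mono1)
    moreover have "v (Suc m) < b" using Suc.prems by simp
    ultimately show ?thesis by simp
  qed
qed simp

abbreviation word_weight :: "nat \<Rightarrow> (nat \<Rightarrow> nat) \<Rightarrow> nat" where
  "word_weight n \<equiv> lex_weight (Suc n) n"

lemma word_weight_less:
  assumes "v permutes {1..n}" "j \<in> {1..n}" "\<And>x. 1 \<le> x \<Longrightarrow> x < j \<Longrightarrow> v x = u x" "v j < u j"
  shows "word_weight n v < word_weight n u"
proof (rule lex_weight_less[of j])
  show "j \<in> {1..n}" "v j < u j" by (fact assms)+
  show "v x = u x" if "1 \<le> x" "x < j" for x using that by (rule assms(3))
  fix x assume "x \<in> {1..n}"
  then have "v x \<in> {1..n}" using permutes_in_image[OF assms(1)] by blast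
  then show "v x < Suc n" by simp
qed

lemma word_weight_ascent:
  assumes "w permutes {1..n}" "k \<in> {1..n-1}" "k \<notin> Des n w"
  shows "word_weight n w < word_weight n (w \<circ> s_perm k)"
proof (rule word_weight_less[OF assms(1), of k])
  have "w k \<noteq> w (Suc k)" using permutes_inj[OF assms(1)] by (auto simp: inj_eq)
  then show "w k < (w \<circ> s_perm k) k" using assms(2,3) by (auto simp: Des_def s_perm_eq)
qed (use assms(2) in \<open>auto simp: s_perm_eq transpose_def\<close>)

lemma decreasing_on_run_of_descents:
  assumes "{x..<y} \<subseteq> Des n w" "x < y"
  shows "w y < w x"
  using assms(2,1)
proof (induction rule: strict_inc_induct)
  case (base x)
  then show ?case by (auto simp: Des_def)
next
  case (step x)
  then have "w y < w (Suc x)" by (simp add: subset_iff)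
  moreover have "x \<in> Des n w" using step by auto
  ultimately show ?case by (simp add: Des_def)
qed

text \<open>
  Being decreasing along each run of descents, \<open>w\<close> is the lexicographically largest word in its
  coset. The first position moved by \<open>\<sigma>\<close> receives the value from a later position of the same
  run, which is smaller. Hence \<open>w\<close> is the leading term of \<open>a\<^sub>w\<close>.
\<close>

lemma word_weight_coset:
  assumes w: "w permutes {1..n}" and \<sigma>: "\<sigma> \<in> G_sub n (Des n w)" "\<sigma> \<noteq> id"
  shows "word_weight n (w \<circ> \<sigma>) < word_weight n w"
proof -
  have perm: "\<sigma> permutes {1..n}" and block: "\<And>x. {min x (\<sigma> x)..<max x (\<sigma> x)} \<subseteq> Des n w"
    using G_sub_same_block[OF \<sigma>(1) Des_subset] by auto
  define j where "j = (LEAST x. \<sigma> x \<noteq> x)"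
  have ex: "\<exists>x. \<sigma> x \<noteq> x" using \<sigma>(2) by (auto simp: fun_eq_iff)
  have j: "\<sigma> j \<noteq> j" unfolding j_def by (rule LeastI_ex[OF ex])
  have below: "\<sigma> x = x" if "x < j" for x using not_less_Least[of x "\<lambda>x. \<sigma> x \<noteq> x"] that j_def by auto
  have "j < \<sigma> j"
  proof (rule ccontr)
    assume "\<not> j < \<sigma> j"
    then have "\<sigma> (\<sigma> j) = \<sigma> j" using below j by auto
    then show False using j permutes_inj[OF perm] by (auto simp: inj_eq)
  qed
  then have "w (\<sigma> j) < w j" using block[of j] decreasing_on_run_of_descents[of j "\<sigma> j" n w] by simp
  moreover have "j \<in> {1..n}" using j perm by (auto simp: permutes_def)
  ultimately show ?thesis
    using below word_weight_less[OF permutes_compose[OF perm w], of j w] by simp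
qed

definition in_a_span :: "nat \<Rightarrow> (nat \<Rightarrow> nat) set \<Rightarrow> ((nat \<Rightarrow> nat) \<Rightarrow> 'k::{comm_ring, comm_monoid_mult}) \<Rightarrow> bool"
  where "in_a_span n V f \<longleftrightarrow> (\<exists>c. f = (\<Sum>v\<in>V. ga_smult (c v) (a_elt n v)))"

lemma in_a_span_zero: "in_a_span n V 0"
  unfolding in_a_span_def
  by (rule exI[of _ "\<lambda>_. 0"]) (simp add: ga_smult_def fun_eq_iff sum_fun_apply)

lemma in_a_span_add:
  assumes "in_a_span n V f" "in_a_span n V g"
  shows "in_a_span n V (f + g)"
proof -
  from assms obtain c d where
    "f = (\<Sum>v\<in>V. ga_smult (c v) (a_elt n v))" "g = (\<Sum>v\<in>V. ga_smult (d v) (a_elt n v))"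
    by (auto simp: in_a_span_def)
  then have "f + g = (\<Sum>v\<in>V. ga_smult (c v + d v) (a_elt n v))"
    by (simp add: ga_smult_def fun_eq_iff sum_fun_apply distrib_right sum.distrib)
  then show ?thesis unfolding in_a_span_def by (rule exI[of _ "\<lambda>v. c v + d v"])
qed

lemma in_a_span_mono:
  assumes "in_a_span n V f" "V \<subseteq> W" "finite W"
  shows "in_a_span n W f"
proof -
  from assms(1) obtain c where "f = (\<Sum>v\<in>V. ga_smult (c v) (a_elt n v))"
    by (auto simp: in_a_span_def)
  also have "\<dots> = (\<Sum>v\<in>V. ga_smult (if v \<in> V then c v else 0) (a_elt n v))"
    by (intro sum.cong) auto
  also have "\<dots> = (\<Sum>v\<in>W. ga_smult (if v \<in> V then c v else 0) (a_elt n v))"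
    using assms(2,3) by (intro sum.mono_neutral_left) (auto simp: ga_smult_def fun_eq_iff)
  finally show ?thesis
    unfolding in_a_span_def by (rule exI[of _ "\<lambda>v. if v \<in> V then c v else 0"])
qed

text \<open>
  Elimination of leading terms. If \<open>w\<close> has maximal weight in the support of an invariant \<open>f\<close>, then
  every \<open>k \<in> K\<close> is a descent of \<open>w\<close>, because at an ascent \<open>w \<circ> s\<^sub>k\<close> would have the same
  coefficient and a larger weight. So \<open>a\<^sub>w\<close> is one of the allowed elements, is \<open>K\<close>-invariant, and has
  \<open>w\<close> as its leading term with coefficient \<open>1\<close>, and subtracting \<open>f w\<close> times it lowers the weight of the
  support.
\<close>

lemma invariant_in_a_span:
  fixes f :: "(nat \<Rightarrow> nat) \<Rightarrow> 'k::{comm_ring, comm_monoid_mult}"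
  assumes "invariant_under K f" "\<And>\<tau>. \<tau> \<notin> carrier (sym_group n) \<Longrightarrow> f \<tau> = 0" and K: "K \<subseteq> {1..n-1}"
  shows "in_a_span n {v \<in> carrier (sym_group n). K \<subseteq> Des n v} f"
proof -
  let ?S = "carrier (sym_group n)"
  let ?V = "{v \<in> ?S. K \<subseteq> Des n v}"
  have finV: "finite ?V" by (simp add: finite_sym_group)
  have bounded: "in_a_span n ?V g"
    if "invariant_under K g" "\<And>\<tau>. \<tau> \<notin> ?S \<Longrightarrow> g \<tau> = 0" "\<And>\<tau>. N \<le> word_weight n \<tau> \<Longrightarrow> \<tau> \<in> ?S \<Longrightarrow> g \<tau> = 0"
    for N and g :: "(nat \<Rightarrow> nat) \<Rightarrow> 'k"
    using that
  proof (induction N arbitrary: g)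
    case 0
    then have "g \<tau> = 0" for \<tau> by (cases "\<tau> \<in> ?S") auto
    then have "g = 0" by (simp add: fun_eq_iff)
    then show ?case using in_a_span_zero[of n ?V] by (simp only:)
  next
    case (Suc N)
    let ?W = "{v \<in> ?V. word_weight n v = N}"
    define h where "h = (\<Sum>v\<in>?W. ga_smult (g v) (a_elt n v))"
    have h_apply: "h \<tau> = (\<Sum>v\<in>?W. g v * a_elt n v \<tau>)" for \<tau>
      by (simp add: h_def sum_fun_apply ga_smult_def)
    have "in_a_span n ?V (g - h)"
    proof (rule Suc.IH)
      show "invariant_under K (g - h)"
        unfolding invariant_under_def
      proof (intro ballI allI)
        fix k \<tau> assume k: "k \<in> K"
        have "h (\<tau> \<circ> s_perm k) = h \<tau>"
          unfolding h_apply using k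
          by (intro sum.cong) (auto simp: sym_group_carrier invariant_underD[OF a_elt_invariant])
        then show "(g - h) (\<tau> \<circ> s_perm k) = (g - h) \<tau>"
          using invariant_underD[OF Suc.prems(1) k, of \<tau>] by (simp add: o_def)
      qed
      show "(g - h) \<tau> = 0" if "\<tau> \<notin> ?S" for \<tau>
        using that Suc.prems(2) by (simp add: h_apply sym_group_carrier a_elt_support)
      \<comment> \<open>At weight at least \<open>N\<close>, each subtracted \<open>a\<^sub>v\<close> contributes its leading term only.\<close>
      show "(g - h) \<tau> = 0" if \<tau>: "N \<le> word_weight n \<tau>" "\<tau> \<in> ?S" for \<tau>
      proof -
        have lead: "a_elt n v \<tau> = (if v = \<tau> then 1 else 0)" if v: "v \<in> ?W" for v
        proof -
          have perm: "v permutes {1..n}" using v by (simp add: sym_group_carrier)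
          have "\<tau> \<in> (\<circ>) v ` G_sub n (Des n v) \<longleftrightarrow> v = \<tau>"
          proof
            assume "\<tau> \<in> (\<circ>) v ` G_sub n (Des n v)"
            then obtain \<sigma> where "\<sigma> \<in> G_sub n (Des n v)" "\<tau> = v \<circ> \<sigma>" by auto
            then show "v = \<tau>" using word_weight_coset[OF perm, of \<sigma>] v \<tau>(1) by fastforce
          next
            assume "v = \<tau>"
            then show "\<tau> \<in> (\<circ>) v ` G_sub n (Des n v)" using id_in_G_sub by (intro image_eqI[of _ _ id]) auto
          qed
          then show ?thesis unfolding a_elt_apply[OF perm] by simp
        qed
        have "h \<tau> = (\<Sum>v\<in>?W. if v = \<tau> then g v else 0)"
          unfolding h_apply by (intro sum.cong) (auto simp: lead)
        also have "\<dots> = (if \<tau> \<in> ?W then g \<tau> else 0)"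
          by (rule sum.delta) (simp add: finite_sym_group)
        also have "\<dots> = g \<tau>"
        proof (cases "\<tau> \<in> ?W")
          case False
          have "g \<tau> = 0"
          proof (cases "word_weight n \<tau> = N")
            case True
            then obtain k where k: "k \<in> K" "k \<notin> Des n \<tau>" using False \<tau>(2) by auto
            have perm: "\<tau> permutes {1..n}" using \<tau>(2) by (simp add: sym_group_carrier)
            have kn: "k \<in> {1..n-1}" using k(1) K by auto
            have "Suc N \<le> word_weight n (\<tau> \<circ> s_perm k)"
              using word_weight_ascent[OF perm kn k(2)] True by simp
            moreover have "\<tau> \<circ> s_perm k \<in> ?S"
              using permutes_compose[OF s_perm_permutes[OF kn] perm] by (simp add: sym_group_carrier)
            ultimately have "g (\<tau> \<circ> s_perm k) = 0" by (rule Suc.prems(3))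
            then show ?thesis using invariant_underD[OF Suc.prems(1) k(1), of \<tau>] by (simp add: o_def)
          next
            case False
            then show ?thesis using \<tau> by (intro Suc.prems(3)) auto
          qed
          then show ?thesis by simp
        qed simp
        finally show ?thesis by simp
      qed
    qed
    moreover have "in_a_span n ?W h" unfolding in_a_span_def h_def by (rule exI) (rule refl)
    then have "in_a_span n ?V h" by (rule in_a_span_mono) (use finV in auto)
    ultimately have "in_a_span n ?V (g - h + h)" by (rule in_a_span_add)
    moreover have "g - h + h = g" by (simp add: fun_eq_iff)
    ultimately show ?case by simp
  qed
  define N where "N = Suc (Max (word_weight n ` ?S))"
  have small: "\<not> N \<le> word_weight n \<tau>" if "\<tau> \<in> ?S" for \<tau>
    using Max_ge[OF finite_imageI[OF finite_sym_group], of "word_weight n \<tau>" "word_weight n" n] that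
    by (auto simp: N_def)
  show ?thesis
  proof (rule bounded)
    show "invariant_under K f" by (fact assms(1))
    show "f \<tau> = 0" if "\<tau> \<notin> ?S" for \<tau> using that by (rule assms(2))
    show "f \<tau> = 0" if "N \<le> word_weight n \<tau>" "\<tau> \<in> ?S" for \<tau> using small that by blast
  qed
qed

section \<open>Reduction to lacunar sets\<close>

text \<open>
  Replace \<open>x\<close> by \<open>x - 1\<close>, or drop it when \<open>x = 1\<close>. The only index that could enter the primed set is
  \<open>x\<close> itself, and it is kept out by \<open>x + 1 \<in> I\<close> or, if \<open>x = n\<close>, by the range \<open>{1..n-1}\<close>.
\<close>

lemma lower_element_prime_set_subset:
  assumes "I \<subseteq> {1..n}" "x \<in> I" "x + 1 \<in> I \<or> x = n"
  shows "\<exists>K\<subseteq>{1..n}. \<Sum>K < \<Sum>I \<and> prime_set n K \<subseteq> prime_set n I"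
proof -
  define K where "K = (I - {x}) \<union> ({x - 1} - {0})"
  have fin: "finite I" using assms(1) finite_subset by blast
  have "1 \<le> x" "x \<le> n" using assms(1,2) by auto
  have "\<Sum>K \<le> \<Sum>(I - {x}) + \<Sum>({x - 1} - {0})"
    unfolding K_def using fin sum.union_inter[of "I - {x}" "{x - 1} - {0}" "\<lambda>y. y"] by simp
  also have "\<Sum>({x - 1} - {0}) = x - 1" by (cases "x - 1 = 0") (auto simp: insert_Diff_if)
  also have "\<Sum>(I - {x}) + (x - 1) < \<Sum>I"
    using sum.remove[OF fin assms(2), of "\<lambda>y. y"] \<open>1 \<le> x\<close> by simp
  finally have "\<Sum>K < \<Sum>I" .
  moreover have "K \<subseteq> {1..n}" using assms(1) \<open>1 \<le> x\<close> \<open>x \<le> n\<close> by (auto simp: K_def)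
  moreover have "prime_set n K \<subseteq> prime_set n I"
    using assms by (auto simp: prime_set_def K_def)
  ultimately show ?thesis by blast
qed

lemma lacunar_reduction:
  assumes "I \<subseteq> {1..n}"
  shows "\<exists>K\<subseteq>{1..n-1}. lacunar K \<and> \<Sum>K \<le> \<Sum>I \<and> prime_set n K \<subseteq> prime_set n I"
  using assms
proof (induction "\<Sum>I" arbitrary: I rule: less_induct)
  case less
  show ?case
  proof (cases "\<exists>x\<in>I. x + 1 \<in> I \<or> x = n")
    case True
    then obtain J where J: "J \<subseteq> {1..n}" "\<Sum>J < \<Sum>I" "prime_set n J \<subseteq> prime_set n I"
      using lower_element_prime_set_subset[OF less.prems] by blast
    from less.hyps[OF J(2,1)] obtain K where
      "K \<subseteq> {1..n-1}" "lacunar K" "\<Sum>K \<le> \<Sum>J" "prime_set n K \<subseteq> prime_set n J" by blast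
    then show ?thesis using J by (intro exI[of _ K]) auto
  next
    case False
    then have "I \<subseteq> {1..n-1}" "lacunar I"
      using less.prems by (fastforce simp: lacunar_def)+
    then show ?thesis by blast
  qed
qed

section \<open>Invariance of block sums\<close>

lemma invariant_inv_cyc:
  assumes "invariant_under K q" "l \<le> r" "{l..<r} \<subseteq> K"
  shows "q (\<tau> \<circ> inv_cyc l r) = q \<tau>"
  using assms(2,3)
proof (induction r arbitrary: \<tau> rule: dec_induct)
  case base
  then show ?case by (simp add: inv_cyc_self)
next
  case (step r)
  have "q (\<tau> \<circ> inv_cyc l (Suc r)) = q ((\<tau> \<circ> s_perm r) \<circ> inv_cyc l r)"
    using step.hyps by (simp only: comp_assoc inv_cyc_right)
  also have "\<dots> = q (\<tau> \<circ> s_perm r)" using step by (intro step.IH) auto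
  also have "\<dots> = q \<tau>" using step by (intro invariant_underD[OF assms(1)]) auto
  finally show ?case .
qed

text \<open>
  How \<open>s\<^sub>i\<close> acts on the product of \<open>q\<close> with the cycles from \<open>r\<close> to \<open>j\<close>, summed over \<open>a \<le> j < b\<close>,
  depends on the position of \<open>i\<close>: left of \<open>r\<close> or from \<open>b\<close> on it commutes with every cycle; between
  \<open>r\<close> and \<open>a\<close> it becomes \<open>s\<^bsub>i+1\<^esub>\<close> in every term. For \<open>i\<close> inside the block it commutes with the shorter
  cycles, becomes \<open>s\<^bsub>i+1\<^esub>\<close> for the longer ones, and exchanges the terms \<open>j = i\<close> and \<open>j = i + 1\<close>.
  That exchange is the only reason for working with whole blocks instead of single cycles, and
  it is what makes \<open>i = a\<close> admissible.
\<close>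

lemma block_sum_invariant_step:
  assumes inv: "invariant_under K q" and "r \<le> a"
    and i: "Suc i < r \<and> i \<in> K \<or> b \<le> i \<and> i \<in> K \<or> r \<le> i \<and> Suc (Suc i) \<le> a \<and> Suc i \<in> K
       \<or> a \<le> i \<and> Suc (Suc i) \<le> b \<and> {Suc a..<b - 1} \<subseteq> K"
  shows "(\<Sum>j\<in>{a..<b}. q (\<tau> \<circ> s_perm i \<circ> inv_cyc r j)) = (\<Sum>j\<in>{a..<b}. q (\<tau> \<circ> inv_cyc r j))"
proof -
  have outside: "q (\<tau> \<circ> s_perm i \<circ> inv_cyc r j) = q (\<tau> \<circ> inv_cyc r j)"
    if "r \<le> j" "Suc i < r \<or> j < i" "i \<in> K" for j
    using invariant_underD[OF inv that(3), of "\<tau> \<circ> inv_cyc r j"] inv_cyc_commute_outside[OF that(1,2)]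
    by (simp only: comp_assoc)
  have inside: "q (\<tau> \<circ> s_perm i \<circ> inv_cyc r j) = q (\<tau> \<circ> inv_cyc r j)"
    if "r \<le> i" "Suc (Suc i) \<le> j" "Suc i \<in> K" for j
    using invariant_underD[OF inv that(3), of "\<tau> \<circ> inv_cyc r j"] inv_cyc_shift_inside[OF that(1,2)]
    by (simp only: comp_assoc)
  from i consider "Suc i < r" "i \<in> K" | "b \<le> i" "i \<in> K" | "r \<le> i" "Suc (Suc i) \<le> a" "Suc i \<in> K"
    | "a \<le> i" "Suc (Suc i) \<le> b" "{Suc a..<b - 1} \<subseteq> K" by blast
  then show ?thesis
  proof cases
    case 4
    have "q (\<tau> \<circ> s_perm i \<circ> inv_cyc r j) = q (\<tau> \<circ> inv_cyc r (transpose i (Suc i) j))"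
      if j: "j \<in> {a..<b}" for j
    proof -
      consider "j < i" | "j = i" | "j = Suc i" | "Suc (Suc i) \<le> j" by linarith
      then show ?thesis
      proof cases
        case 1
        then have "i \<in> K" using 4 j by auto
        then show ?thesis using 1 outside[of j] j assms(2) by simp
      next
        case 2
        then show ?thesis using inv_cyc_right[of r j] j assms(2) by (simp add: comp_assoc)
      next
        case 3
        then show ?thesis using inv_cyc_right'[of r i] 4 assms(2) by (simp add: comp_assoc)
      next
        case c4: 4
        then have "Suc i \<in> K" using 4 j by auto
        then show ?thesis using c4 inside[of j] 4 assms(2) by simp
      qed
    qed
    then have "(\<Sum>j\<in>{a..<b}. q (\<tau> \<circ> s_perm i \<circ> inv_cyc r j))
        = (\<Sum>j\<in>{a..<b}. q (\<tau> \<circ> inv_cyc r (transpose i (Suc i) j)))"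
      by (rule sum.cong[OF refl])
    also have "\<dots> = (\<Sum>j\<in>{a..<b}. q (\<tau> \<circ> inv_cyc r j))"
      using 4 by (intro sum.reindex_bij_witness[of _ "transpose i (Suc i)" "transpose i (Suc i)"])
        (auto simp: transpose_def)
    finally show ?thesis .
  qed (use outside inside assms(2) in \<open>auto intro!: sum.cong\<close>)
qed

text \<open>
  The elements of \<open>I\<close> in \<open>{p..a}\<close> are lowered by one, an element \<open>1\<close> being dropped instead.
\<close>

definition lower_between :: "nat set \<Rightarrow> nat \<Rightarrow> nat \<Rightarrow> nat set" where
  "lower_between I p a = {x \<in> I. x < p \<or> a < x} \<union> ((\<lambda>x. x - 1) ` {x \<in> I. p \<le> x \<and> x \<le> a} - {0})"

lemma lower_between_subset: "I \<subseteq> {1..n} \<Longrightarrow> lower_between I p a \<subseteq> {1..n}"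
  by (force simp: lower_between_def)

lemma sum_lower_between:
  assumes "finite I" "0 \<notin> I" "p \<in> I" "p \<le> a"
  shows "\<Sum>(lower_between I p a) < \<Sum>I"
proof -
  let ?U = "{x \<in> I. x < p \<or> a < x}" and ?M = "{x \<in> I. p \<le> x \<and> x \<le> a}"
  have "\<Sum>(lower_between I p a) \<le> \<Sum>?U + \<Sum>((\<lambda>x. x - 1) ` ?M - {0})"
    unfolding lower_between_def
    using assms(1) sum.union_inter[of ?U "(\<lambda>x. x - 1) ` ?M - {0}" "\<lambda>y. y"] by simp
  also have "\<Sum>((\<lambda>x. x - 1) ` ?M - {0}) \<le> \<Sum>((\<lambda>x. x - 1) ` ?M)"
    using assms(1) by (intro sum_mono2) auto
  also have "\<dots> \<le> (\<Sum>x\<in>?M. x - 1)"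
    using sum_image_le[of ?M "\<lambda>y. y" "\<lambda>x. x - 1"] assms(1) by simp
  also have "\<dots> < \<Sum>?M"
  proof (rule sum_strict_mono_ex1)
    have "p \<noteq> 0" using assms(2,3) by metis
    then show "\<exists>x\<in>?M. x - 1 < x" using assms(3,4) by (intro bexI[of _ p]) auto
  qed (use assms(1) in auto)
  also have "\<Sum>?U + \<Sum>?M = \<Sum>I"
    using assms(1) by (subst sum.union_disjoint[symmetric]) (auto intro!: sum.cong)
  finally show ?thesis by simp
qed

text \<open>
  Let \<open>J\<close> be \<open>I\<close> with its elements in \<open>{p..a}\<close> lowered, where \<open>a < b\<close> are neighbours in \<open>I\<close> extended by
  \<open>n + 1\<close>. The gaps of \<open>J\<close> are just those for which \<open>s\<^sub>i\<close> falls into a good case of the previous lemma: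
  \<open>p - 1\<close> and \<open>a - 1\<close> lie in \<open>J\<close> if positive and exclude the boundary indices
  \<open>i = p - 2, p - 1, a - 2, a - 1\<close>; \<open>b\<close> lies in \<open>J\<close> or is \<open>n + 1\<close>, which excludes \<open>i = b - 1\<close>;
  and between \<open>p\<close> and \<open>a\<close> the shift of \<open>I\<close> to the left matches the passage from \<open>s\<^sub>i\<close> to \<open>s\<^bsub>i+1\<^esub>\<close>.
\<close>

lemma block_sum_invariant:
  assumes I: "I \<subseteq> {1..n}" and inv: "invariant_under (prime_set n I) q"
    and l: "1 \<le> l" "l \<le> p" "{l..<p} \<inter> I = {}" and p: "p \<in> I"
    and a: "a \<in> I" "p \<le> a" and b: "a < b" "{a<..<b} \<inter> I = {}" "b \<in> I \<or> b = n + 1"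
  shows "invariant_under (prime_set n (lower_between I p a)) (\<lambda>\<tau>. \<Sum>j\<in>{a..<b}. q (\<tau> \<circ> inv_cyc l j))"
proof -
  \<comment> \<open>The part of the cycle from \<open>l\<close> to \<open>p - 1\<close> is absorbed by \<open>q\<close>. Afterwards the cycles start at
    \<open>p - 1\<close> (at \<open>p\<close> if \<open>l = p\<close>), so that \<open>s\<^sub>i\<close> commutes with them for every \<open>i < p - 2\<close>; with the
    original cycles, \<open>i = l - 1\<close> would be out of control if \<open>l < p\<close>.\<close>
  define r where "r = max l (p - 1)"
  have r: "l \<le> r" "r \<le> p" "p \<le> Suc r" using l by (auto simp: r_def)
  have bn: "b \<le> n + 1" and an: "a \<le> n" using b(3) I a(1) by auto
  have reduce: "q (\<tau> \<circ> inv_cyc l j) = q (\<tau> \<circ> inv_cyc r j)" if "j \<in> {a..<b}" for j \<tau>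
  proof -
    have "i \<in> prime_set n I" if "i \<in> {l..<r}" for i
    proof -
      have "i + 1 < p" using that by (auto simp: r_def split: if_splits)
      moreover have "y \<notin> I" if "l \<le> y" "y < p" for y using that l(3) by auto
      then have "i \<notin> I" "i + 1 \<notin> I" using that \<open>i + 1 < p\<close> by auto
      ultimately show ?thesis using that l(1) a(2) an by (auto simp: prime_set_def)
    qed
    then have "q ((\<tau> \<circ> inv_cyc r j) \<circ> inv_cyc l r) = q (\<tau> \<circ> inv_cyc r j)"
      using r(1) by (intro invariant_inv_cyc[OF inv]) auto
    moreover have "inv_cyc l j = inv_cyc r j \<circ> inv_cyc l r"
      using that r a(2) by (intro inv_cyc_split) auto
    ultimately show ?thesis by (simp only: comp_assoc)
  qed
  show ?thesis
    unfolding invariant_under_def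
  proof (intro ballI allI)
    fix i \<tau> assume "i \<in> prime_set n (lower_between I p a)"
    then have i: "1 \<le> i" "i \<le> n - 1" "i \<notin> lower_between I p a" "Suc i \<notin> lower_between I p a"
      by (auto simp: prime_set_def)
    have pred: "x - 1 \<in> lower_between I p a" if "x \<in> I" "p \<le> x" "x \<le> a" "1 < x" for x
      using that by (auto simp: lower_between_def)
    have same: "x \<in> lower_between I p a" if "x \<in> I" "x < p \<or> a < x" for x
      using that by (auto simp: lower_between_def)
    have not_pred: "Suc i \<noteq> p - 1 \<and> i \<noteq> p - 1 \<and> i \<noteq> a - 1 \<and> Suc i \<noteq> a - 1"
      using i pred[of p] pred[of a] p a by (auto simp: Suc_le_eq)
    consider "Suc (Suc i) < p" | "p \<le> i" "Suc (Suc i) \<le> a" | "a \<le> i" "Suc (Suc i) \<le> b" | "b \<le> i"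
    proof -
      have "Suc i \<noteq> b" using i same[of b] b a by auto
      then show ?thesis using that not_pred i(1) by linarith
    qed
    then have "Suc i < r \<and> i \<in> prime_set n I \<or> b \<le> i \<and> i \<in> prime_set n I
       \<or> r \<le> i \<and> Suc (Suc i) \<le> a \<and> Suc i \<in> prime_set n I
       \<or> a \<le> i \<and> Suc (Suc i) \<le> b \<and> {Suc a..<b - 1} \<subseteq> prime_set n I"
    proof cases
      case 1
      then have "i \<in> prime_set n I" using i same[of i] same[of "Suc i"] by (auto simp: prime_set_def)
      then show ?thesis using 1 r by auto
    next
      case 2
      then have "Suc i \<in> prime_set n I"
        using i pred[of "Suc i"] pred[of "Suc (Suc i)"] an by (auto simp: prime_set_def)
      then show ?thesis using 2 r by auto
    next
      case 3
      have free: "y \<notin> I" if "a < y" "y < b" for y using that b(2) by auto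
      have "{Suc a..<b - 1} \<subseteq> prime_set n I"
        using free bn by (auto simp: prime_set_def)
      then show ?thesis using 3 by auto
    next
      case 4
      then have "i \<in> prime_set n I"
        using i same[of i] same[of "Suc i"] b(1) by (auto simp: prime_set_def)
      then show ?thesis using 4 by auto
    qed
    then have "(\<Sum>j\<in>{a..<b}. q (\<tau> \<circ> s_perm i \<circ> inv_cyc r j)) = (\<Sum>j\<in>{a..<b}. q (\<tau> \<circ> inv_cyc r j))"
      using r(2) a(2) by (intro block_sum_invariant_step[OF inv]) auto
    then show "(\<Sum>j\<in>{a..<b}. q (\<tau> \<circ> s_perm i \<circ> inv_cyc l j)) = (\<Sum>j\<in>{a..<b}. q (\<tau> \<circ> inv_cyc l j))"
      by (simp add: reduce)
  qed
qed

section \<open>Triangularity of right multiplication by \<open>t\<^sub>l\<close>\<close>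

text \<open>
  Here \<open>J\<close> may be any subset of \<open>[n]\<close>, as it can be reduced to a lacunar set that occurs in the listing.
  With \<open>J = [n]\<close>, whose primed set is empty, this shows in particular that the index is well defined.
\<close>

lemma Qind_bound:
  assumes "lacunar_listing n Q" "J \<subseteq> {1..n}" "prime_set n J \<subseteq> Des n v"
  shows "Qind n Q v \<in> {1..fib (n + 1)}" "prime_set n (Q (Qind n Q v)) \<subseteq> Des n v"
    "\<Sum>(Q (Qind n Q v)) \<le> \<Sum>J"
proof -
  obtain K where K: "K \<subseteq> {1..n-1}" "lacunar K" "\<Sum>K \<le> \<Sum>J" "prime_set n K \<subseteq> prime_set n J"
    using lacunar_reduction[OF assms(2)] by blast
  have bij: "bij_betw Q {1..fib (n + 1)} {I. I \<subseteq> {1..n-1} \<and> lacunar I}"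
    and mono: "mono_on {1..fib (n + 1)} (\<lambda>i. \<Sum>(Q i))"
    using assms(1) by (auto simp: lacunar_listing_def)
  have "K \<in> Q ` {1..fib (n + 1)}"
    unfolding bij_betw_imp_surj_on[OF bij] using K by simp
  then obtain k where k: "k \<in> {1..fib (n + 1)}" "Q k = K" by auto
  have good: "k \<in> {1..fib (n + 1)} \<and> prime_set n (Q k) \<subseteq> Des n v"
    using k K(4) assms(3) by auto
  show range: "Qind n Q v \<in> {1..fib (n + 1)}" and "prime_set n (Q (Qind n Q v)) \<subseteq> Des n v"
    using LeastI[of "\<lambda>i. i \<in> {1..fib (n + 1)} \<and> prime_set n (Q i) \<subseteq> Des n v", OF good]
    unfolding Qind_def by blast+
  have "Qind n Q v \<le> k" unfolding Qind_def using good by (rule Least_le)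
  then show "\<Sum>(Q (Qind n Q v)) \<le> \<Sum>J"
    using mono_onD[OF mono range k(1)] k(2) K(3) by simp
qed

lemma scalar_of_nat_mult: "scalar_of_nat m * x = (\<Sum>j<m. x)"
  by (simp add: scalar_of_nat_def sum_distrib_right)

theorem theorem11p1:
  fixes n l i :: nat and w :: "nat \<Rightarrow> nat" and Q :: "nat \<Rightarrow> nat set"
  assumes "lacunar_listing n Q"
    and "w \<in> carrier (sym_group n)"
    and "l \<in> {1..n}"
    and "i = Qind n Q w"
  shows "\<exists>c :: (nat \<Rightarrow> nat) \<Rightarrow> 'k::{comm_ring, comm_monoid_mult}.
    ga_mult n (a_elt n w) (t_elt n l) =
      ga_smult (scalar_of_nat (m_coeff n (Q i) l)) (a_elt n w) +
      (\<Sum>v\<in>{v \<in> carrier (sym_group n). Qind n Q v < i}. ga_smult (c v) (a_elt n v))"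
proof -
  let ?S = "carrier (sym_group n)"
  define V where "V = {v \<in> ?S. Qind n Q v < i}"
  define q :: "(nat \<Rightarrow> nat) \<Rightarrow> 'k" where "q = a_elt n w"
  define I where "I = Q i"
  have w: "w permutes {1..n}" using assms(2) by (simp add: sym_group_carrier)
  have "prime_set n {1..n} \<subseteq> Des n w" by (auto simp: prime_set_def)
  note Qw = Qind_bound(1,2)[OF assms(1) subset_refl this, folded assms(4), folded I_def]
  have I: "I \<subseteq> {1..n}"
  proof -
    have "I \<in> {I. I \<subseteq> {1..n-1} \<and> lacunar I}"
      using assms(1) Qw(1) unfolding I_def lacunar_listing_def by (blast dest: bij_betwE)
    then have "I \<subseteq> {1..n-1}" by simp
    also have "\<dots> \<subseteq> {1..n}" by auto
    finally show ?thesis .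
  qed
  have finI: "finite I" using I finite_subset by blast
  have inv: "invariant_under (prime_set n I) q"
    unfolding q_def using a_elt_invariant[OF w] Qw(2) by (rule invariant_under_mono)
  have supp: "q \<tau> = 0" if "\<tau> \<notin> ?S" for \<tau>
    unfolding q_def using w that by (rule a_elt_support)
  \<comment> \<open>Strict inequality of the sums gives strict inequality of the indices, however the listing
    breaks ties between equal sums.\<close>
  have in_V: "in_a_span n V f"
    if J: "J \<subseteq> {1..n}" "\<Sum>J < \<Sum>I" and f: "invariant_under (prime_set n J) f" "\<And>\<tau>. \<tau> \<notin> ?S \<Longrightarrow> f \<tau> = 0"
    for J and f :: "(nat \<Rightarrow> nat) \<Rightarrow> 'k"
  proof (rule in_a_span_mono)
    show "in_a_span n {v \<in> ?S. prime_set n J \<subseteq> Des n v} f"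
      using f by (rule invariant_in_a_span) (auto simp: prime_set_def)
    show "{v \<in> ?S. prime_set n J \<subseteq> Des n v} \<subseteq> V"
    proof
      fix v assume v: "v \<in> {v \<in> ?S. prime_set n J \<subseteq> Des n v}"
      then have "prime_set n J \<subseteq> Des n v" by simp
      note Qv = Qind_bound(1,3)[OF assms(1) J(1) this]
      have "Qind n Q v < i"
      proof (rule ccontr)
        assume "\<not> Qind n Q v < i"
        moreover have "mono_on {1..fib (n + 1)} (\<lambda>i. \<Sum>(Q i))"
          using assms(1) by (simp add: lacunar_listing_def)
        ultimately have "\<Sum>I \<le> \<Sum>(Q (Qind n Q v))"
          unfolding I_def using mono_onD[OF _ Qw(1) Qv(1)] by (simp add: not_less)
        then show False using J(2) Qv(2) by simp
      qed
      then show "v \<in> V" using v by (simp add: V_def)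
    qed
    show "finite V" by (simp add: V_def finite_sym_group)
  qed
  define p where "p = (LEAST k. k \<in> hat n I \<and> l \<le> k)"
  have p_ex: "n + 1 \<in> hat n I \<and> l \<le> n + 1" using assms(3) by (simp add: hat_def)
  have p: "p \<in> hat n I" "l \<le> p" using LeastI[of "\<lambda>k. k \<in> hat n I \<and> l \<le> k", OF p_ex] by (auto simp: p_def)
  have p_le: "p \<le> x" if "x \<in> hat n I" "l \<le> x" for x
    unfolding p_def using that by (intro Least_le) simp
  have pn: "p \<le> n + 1" using p_le p_ex by blast
  have m: "m_coeff n I l = p - l" by (simp add: m_coeff_def p_def)
  have gap: "{l..<p} \<inter> I = {}" using p_le by (force simp: hat_def)
  have gap': "y \<notin> I" if "l \<le> y" "y < p" for y using gap that by auto
  \<comment> \<open>The remainder is cut into blocks from the left: each \<open>tail a\<close> is one block plus the tail that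
    starts at the next element of \<open>I\<close>.\<close>
  define tail where "tail a = (\<lambda>\<tau>. \<Sum>j\<in>{a..<n+1}. q (\<tau> \<circ> inv_cyc l j))" for a
  have tail_in_V: "in_a_span n V (tail a)" if "p \<le> a" "a \<in> I \<or> a = n + 1" for a
    using that
  proof (induction "n + 1 - a" arbitrary: a rule: less_induct)
    case less
    show ?case
    proof (cases "a = n + 1")
      case True
      then have "tail a = 0" by (simp add: tail_def fun_eq_iff)
      then show ?thesis using in_a_span_zero[of n V] by simp
    next
      case False
      then have a: "a \<in> I" "a \<le> n" using less.prems I by auto
      have pI: "p \<in> I" using p less.prems(1) a assms(3) by (auto simp: hat_def)
      define b where "b = (LEAST k. (k \<in> I \<or> k = n + 1) \<and> a < k)"
      have ex: "(n + 1 \<in> I \<or> n + 1 = n + 1) \<and> a < n + 1" using a by simp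
      have b: "b \<in> I \<or> b = n + 1" "a < b"
        using LeastI[of "\<lambda>k. (k \<in> I \<or> k = n + 1) \<and> a < k", OF ex] unfolding b_def by auto
      have b_le: "b \<le> x" if "x \<in> I" "a < x" for x
        unfolding b_def using that by (intro Least_le) simp
      have bn: "b \<le> n + 1" using b(1) I by auto
      define block where "block = (\<lambda>\<tau>. \<Sum>j\<in>{a..<b}. q (\<tau> \<circ> inv_cyc l j))"
      have "in_a_span n V block"
      proof (rule in_V)
        show "lower_between I p a \<subseteq> {1..n}" using I by (rule lower_between_subset)
        show "\<Sum>(lower_between I p a) < \<Sum>I"
          using finI I pI less.prems(1) by (intro sum_lower_between) auto
        show "invariant_under (prime_set n (lower_between I p a)) block"
          unfolding block_def using assms(3) p(2) gap pI a less.prems(1) b b_le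
          by (intro block_sum_invariant[OF I inv]) force+
        fix \<tau> assume \<tau>: "\<tau> \<notin> ?S"
        have "\<tau> \<circ> inv_cyc l j \<notin> ?S" if j: "j \<in> {a..<b}" for j
        proof
          assume "\<tau> \<circ> inv_cyc l j \<in> ?S"
          moreover have perm: "inv_cyc l j permutes {1..n}"
            using j bn assms(3) p(2) less.prems(1) by (intro inv_cyc_permutes) auto
          ultimately have "(\<tau> \<circ> inv_cyc l j) \<circ> inv' (inv_cyc l j) \<in> ?S"
            by (simp only: sym_group_carrier permutes_compose permutes_inv)
          then show False using \<tau> permutes_inv_o(1)[OF perm] by (simp only: comp_assoc comp_id)
        qed
        then show "block \<tau> = 0" by (simp add: block_def supp)
      qed
      moreover have "in_a_span n V (tail b)"
        using less.hyps[of b] less.prems(1) b bn by simp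
      ultimately have "in_a_span n V (block + tail b)" by (rule in_a_span_add)
      moreover have "tail a = block + tail b"
        unfolding tail_def block_def fun_eq_iff plus_fun_apply
        using sum.atLeastLessThan_concat[OF less_imp_le[OF b(2)] bn] by metis
      ultimately show ?thesis by simp
    qed
  qed
  have "in_a_span n V (tail p)"
    using p assms(3) by (intro tail_in_V) (auto simp: hat_def)
  then obtain c where c: "tail p = (\<Sum>v\<in>V. ga_smult (c v) (a_elt n v))"
    by (auto simp: in_a_span_def)
  have "ga_mult n q (t_elt n l) = ga_smult (scalar_of_nat (m_coeff n I l)) q + tail p"
  proof
    fix \<tau>
    have head: "q (\<tau> \<circ> inv_cyc l j) = q \<tau>" if "j \<in> {l..<p}" for j
    proof -
      have "{l..<j} \<subseteq> prime_set n I"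
        using gap' that pn assms(3) by (auto simp: prime_set_def)
      then show ?thesis using that by (intro invariant_inv_cyc[OF inv]) auto
    qed
    have "ga_mult n q (t_elt n l) \<tau> = (\<Sum>j\<in>{l..n}. q (\<tau> \<circ> inv_cyc l j))"
      using supp assms(3) by (intro ga_mult_t_elt) auto
    also have "{l..n} = {l..<n+1}" by auto
    also have "(\<Sum>j\<in>{l..<n+1}. q (\<tau> \<circ> inv_cyc l j)) = (\<Sum>j\<in>{l..<p}. q (\<tau> \<circ> inv_cyc l j)) + tail p \<tau>"
      unfolding tail_def using p(2) pn by (rule sum.atLeastLessThan_concat[symmetric])
    also have "(\<Sum>j\<in>{l..<p}. q (\<tau> \<circ> inv_cyc l j)) = (\<Sum>j\<in>{l..<p}. q \<tau>)"
      using head by (intro sum.cong) auto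
    also have "\<dots> = (\<Sum>j<p - l. q \<tau>)"
      by (rule sum.reindex_bij_witness[of _ "\<lambda>j. j + l" "\<lambda>j. j - l"]) auto
    finally show "ga_mult n q (t_elt n l) \<tau>
        = (ga_smult (scalar_of_nat (m_coeff n I l)) q + tail p) \<tau>"
      by (simp add: ga_smult_def scalar_of_nat_mult m)
  qed
  then show ?thesis unfolding c q_def I_def V_def by blast
qed

end
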